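(* Let $L,M$ be bounded distributive lattices, $I$ an ideal of $L$, and $F$ a filter of $M$. Let $X$ be the Priestley space of $L$, $Y$ the Priestley space of $M$, $V$ the open upset of $X$ corresponding to the ideal $I$, $D:=X\setminus V$, and $U$ the closed upset of $Y$ corresponding to the filter $F$. Then the down-up sum $X\oplus_D^U Y$ is homeomorphic and order-isomorphic (by a single map) to the Priestley space of the ideal-filter product $L\times_I^F M$.
   Context: A Priestley space is a compact topological space $X$ with a partial order such that whenever $x\nleq y$ there is a clopen upset containing $x$ and missing $y$. The Priestley space of a bounded distributive lattice $L$ is the set $X$ of prime filters of $L$ ordered by inclusion, with topology given by the basis $\{\alpha(a)\setminus\alpha(b)\mid a,b\in L\}$, where $\alpha(a)=\{x\in X\mid a\in x\}$; $\alpha$ is an isomorphism of $L$ onto the lattice of clopen upsets of $X$. The open upset of $X$ corresponding to an ideal $I$ of $L$ is $\bigcup\{\alpha(a)\mid a\in I\}$, and the closed upset corresponding to a filter $F$ of a lattice is $\bigcap\{\alpha(a)\mid a\in F\}$ (computed in the Priestley space of that lattice). Ideal-filter product: for bounded distributive lattices $L,M$, an ideal $I$ of $L$ and a filter $F$ of $M$, $L\times_I^F M:=\{(l,m)\in L\times M\mid l\in I\text{ or }m\in F\}$, a bounded sublattice of $L\times M$. Down-up sum: for Priestley spaces $X,Y$ (assumed disjoint, replacing them by disjoint copies if necessary), a closed downset $D$ of $X$ and a closed upset $U$ of $Y$, $X\oplus_D^U Y$ is the disjoint union of $X$ and $Y$ with the disjoint union topology and the order: $x\le y$ iff ($x,y\in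 X$ and $x\le y$ in $X$) or ($x,y\in Y$ and $x\le y$ in $Y$) or ($x\in D$ and $y\in U$). *)

theory Defs
  imports "HOL-Analysis.Analysis" "HOL-Library.Product_Order"
begin

section \<open>Bounded sublattices, ideals, filters\<close>

text \<open>
  A bounded distributive lattice is a type of class \<open>{distrib_lattice, bounded_lattice}\<close>; the
  one-element lattice is allowed. The ideal-filter product is only a bounded sublattice of a product
  type, so ideals, filters and Priestley spaces are defined for a bounded sublattice \<open>S\<close> of such a
  type. The whole lattice is the case \<open>S = UNIV\<close>.
\<close>

definition bounded_sublattice :: "'a::bounded_lattice set \<Rightarrow> bool" where
  "bounded_sublattice S \<longleftrightarrow>
     bot \<in> S \<and> top \<in> S \<and> (\<forall>a\<in>S. \<forall>b\<in>S. inf a b \<in> S \<and> sup a b \<in> S)"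

text \<open>Ideals and filters are nonempty, but need not be proper.\<close>

definition lattice_ideal :: "'a::lattice set \<Rightarrow> 'a set \<Rightarrow> bool" where
  "lattice_ideal S I \<longleftrightarrow>
     I \<subseteq> S \<and> I \<noteq> {} \<and> (\<forall>a\<in>I. \<forall>b\<in>S. b \<le> a \<longrightarrow> b \<in> I) \<and> (\<forall>a\<in>I. \<forall>b\<in>I. sup a b \<in> I)"

definition lattice_filter :: "'a::lattice set \<Rightarrow> 'a set \<Rightarrow> bool" where
  "lattice_filter S F \<longleftrightarrow>
     F \<subseteq> S \<and> F \<noteq> {} \<and> (\<forall>a\<in>F. \<forall>b\<in>S. a \<le> b \<longrightarrow> b \<in> F) \<and> (\<forall>a\<in>F. \<forall>b\<in>F. inf a b \<in> F)"

definition prime_filter :: "'a::lattice set \<Rightarrow> 'a set \<Rightarrow> bool" where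
  "prime_filter S x \<longleftrightarrow>
     lattice_filter S x \<and> x \<noteq> S \<and> (\<forall>a\<in>S. \<forall>b\<in>S. sup a b \<in> x \<longrightarrow> a \<in> x \<or> b \<in> x)"

definition ideal_filter_product :: "'a set \<Rightarrow> 'b set \<Rightarrow> ('a \<times> 'b) set" where
  "ideal_filter_product I F = {(l, m). l \<in> I \<or> m \<in> F}"

lemma bounded_sublattice_ideal_filter_product:
  fixes I :: "'a::bounded_lattice set" and F :: "'b::bounded_lattice set"
  assumes I: "lattice_ideal UNIV I" and F: "lattice_filter UNIV F"
  shows "bounded_sublattice (ideal_filter_product I F)"
proof -
  have "bot \<in> I" "\<And>a b. a \<in> I \<Longrightarrow> inf a b \<in> I \<and> inf b a \<in> I" "\<And>a b. a \<in> I \<Longrightarrow> b \<in> I \<Longrightarrow> sup a b \<in> I"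
    using I by (auto simp: lattice_ideal_def)
  moreover have "top \<in> F" "\<And>a b. a \<in> F \<Longrightarrow> sup a b \<in> F \<and> sup b a \<in> F"
      "\<And>a b. a \<in> F \<Longrightarrow> b \<in> F \<Longrightarrow> inf a b \<in> F"
    using F by (auto simp: lattice_filter_def)
  ultimately show ?thesis
    by (auto simp: bounded_sublattice_def ideal_filter_product_def bot_prod_def top_prod_def
        inf_prod_def sup_prod_def)
qed


section \<open>Ordered spaces and Priestley spaces of lattices\<close>

text \<open>The relation \<open>ord_le X\<close> is only relevant on the points of \<open>X\<close>, that is, on \<open>points X\<close>.\<close>

record 'p ordered_space =
  ord_topology :: "'p topology"
  ord_le :: "'p \<Rightarrow> 'p \<Rightarrow> bool"

abbreviation points :: "'p ordered_space \<Rightarrow> 'p set" where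
  "points X \<equiv> topspace (ord_topology X)"

definition homeo_order_isomorphic :: "'p ordered_space \<Rightarrow> 'q ordered_space \<Rightarrow> bool" where
  "homeo_order_isomorphic X Y \<longleftrightarrow>
     (\<exists>f. homeomorphic_map (ord_topology X) (ord_topology Y) f \<and>
          (\<forall>x\<in>points X. \<forall>y\<in>points X. ord_le X x y \<longleftrightarrow> ord_le Y (f x) (f y)))"

definition priestley_alpha :: "'a::lattice set \<Rightarrow> 'a \<Rightarrow> 'a set set" where
  "priestley_alpha S a = {x. prime_filter S x \<and> a \<in> x}"

definition priestley_space :: "'a::lattice set \<Rightarrow> 'a set ordered_space" where
  "priestley_space S =
     \<lparr>ord_topology = topology_generated_by {priestley_alpha S a - priestley_alpha S b |a b. a \<in> S \<and> b \<in> S},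
      ord_le = (\<subseteq>)\<rparr>"

lemma points_priestley_space:
  assumes "bounded_sublattice S"
  shows "points (priestley_space S) = {x. prime_filter S x}"
proof -
  have "top \<in> x" "bot \<notin> x" if "prime_filter S x" for x
    using that assms
    by (auto simp: prime_filter_def lattice_filter_def bounded_sublattice_def)
  then have "{x. prime_filter S x} = priestley_alpha S top - priestley_alpha S bot"
    by (auto simp: priestley_alpha_def)
  moreover have "top \<in> S" "bot \<in> S"
    using assms by (auto simp: bounded_sublattice_def)
  ultimately have "{x. prime_filter S x} \<subseteq>
      \<Union>{priestley_alpha S a - priestley_alpha S b |a b. a \<in> S \<and> b \<in> S}"
    by blast
  then show ?thesis
    by (auto simp: priestley_space_def priestley_alpha_def)
qed

text \<open>The generating family is closed under intersection, so it is a basis and not just a subbasis.\<close>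

lemma openin_priestley_space:
  assumes S: "bounded_sublattice S"
  shows "openin (ord_topology (priestley_space S)) =
    arbitrary union_of (\<lambda>W. \<exists>a\<in>S. \<exists>b\<in>S. W = priestley_alpha S a - priestley_alpha S b)"
    (is "_ = arbitrary union_of ?B")
proof -
  have alpha_inf: "priestley_alpha S (inf a b) = priestley_alpha S a \<inter> priestley_alpha S b"
    if "a \<in> S" "b \<in> S" for a b
  proof -
    have "inf a b \<in> S"
      using S that by (auto simp: bounded_sublattice_def)
    then have "inf a b \<in> x \<longleftrightarrow> a \<in> x \<and> b \<in> x" if "prime_filter S x" for x
      using that \<open>a \<in> S\<close> \<open>b \<in> S\<close> unfolding prime_filter_def lattice_filter_def
      by (meson inf_le1 inf_le2)
    then show ?thesis
      by (auto simp: priestley_alpha_def)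
  qed
  have alpha_sup: "priestley_alpha S (sup a b) = priestley_alpha S a \<union> priestley_alpha S b"
    if "a \<in> S" "b \<in> S" for a b
  proof -
    have "sup a b \<in> S"
      using S that by (auto simp: bounded_sublattice_def)
    then have "sup a b \<in> x \<longleftrightarrow> a \<in> x \<or> b \<in> x" if "prime_filter S x" for x
      using that \<open>a \<in> S\<close> \<open>b \<in> S\<close> unfolding prime_filter_def lattice_filter_def
      by (meson sup_ge1 sup_ge2)
    then show ?thesis
      by (auto simp: priestley_alpha_def)
  qed
  have "?B (W \<inter> W')" if W: "?B W" and W': "?B W'" for W W'
  proof -
    obtain a b c d where abcd: "a \<in> S" "b \<in> S" "c \<in> S" "d \<in> S"
      and eq: "W = priestley_alpha S a - priestley_alpha S b" "W' = priestley_alpha S c - priestley_alpha S d"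
      using W W' by blast
    have "W \<inter> W' = priestley_alpha S (inf a c) - priestley_alpha S (sup b d)"
      unfolding eq using abcd by (auto simp: alpha_inf alpha_sup)
    moreover have "inf a c \<in> S" "sup b d \<in> S"
      using S abcd by (auto simp: bounded_sublattice_def)
    ultimately show ?thesis by blast
  qed
  then have top: "istopology (arbitrary union_of ?B)"
    by (rule istopology_base)
  let ?G = "{priestley_alpha S a - priestley_alpha S b |a b. a \<in> S \<and> b \<in> S}"
  have "generate_topology_on ?G W \<longleftrightarrow> (arbitrary union_of ?B) W" for W
  proof
    assume "generate_topology_on ?G W"
    then show "(arbitrary union_of ?B) W"
    proof (induction rule: generate_topology_on.induct)
      case Empty
      then show ?case by (simp add: arbitrary_union_of_empty)
    next
      case (Int a b)
      then show ?case using top by (simp add: istopology_def)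
    next
      case (UN K)
      then show ?case using top by (simp add: istopology_def)
    next
      case (Basis s)
      then show ?case by (auto intro!: arbitrary_union_of_inc)
    qed
  next
    assume "(arbitrary union_of ?B) W"
    then obtain \<U> where "\<U> \<subseteq> Collect ?B" "\<Union>\<U> = W"
      by (auto simp: union_of_def arbitrary_def)
    then have "generate_topology_on ?G (\<Union>\<U>)"
      by (intro generate_topology_on.UN generate_topology_on.Basis) blast
    with \<open>\<Union>\<U> = W\<close> show "generate_topology_on ?G W"
      by simp
  qed
  then show ?thesis
    by (simp add: fun_eq_iff priestley_space_def openin_topology_generated_by_iff)
qed

definition open_upset_of_ideal :: "'a::lattice set \<Rightarrow> 'a set \<Rightarrow> 'a set set" where
  "open_upset_of_ideal S I = (\<Union>a\<in>I. priestley_alpha S a)"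

definition closed_upset_of_filter :: "'a::lattice set \<Rightarrow> 'a set \<Rightarrow> 'a set set" where
  "closed_upset_of_filter S F = (\<Inter>a\<in>F. priestley_alpha S a)"

lemma openin_closedin_priestley_alpha:
  assumes S: "bounded_sublattice S" and a: "a \<in> S"
  shows "openin (ord_topology (priestley_space S)) (priestley_alpha S a)"
    and "closedin (ord_topology (priestley_space S)) (priestley_alpha S a)"
proof -
  have *: "openin (ord_topology (priestley_space S)) (priestley_alpha S c - priestley_alpha S d)"
    if "c \<in> S" "d \<in> S" for c d
    using that by (auto simp: priestley_space_def intro!: topology_generated_by_Basis)
  have bt: "bot \<in> S" "top \<in> S"
    using S by (auto simp: bounded_sublattice_def)
  have "top \<in> x" "bot \<notin> x" if "prime_filter S x" for x
    using that S
    by (auto simp: prime_filter_def lattice_filter_def bounded_sublattice_def)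
  then have eq: "priestley_alpha S bot = {}" "priestley_alpha S top = {x. prime_filter S x}"
    by (auto simp: priestley_alpha_def)
  show "openin (ord_topology (priestley_space S)) (priestley_alpha S a)"
    using *[OF a bt(1)] by (simp add: eq)
  show "closedin (ord_topology (priestley_space S)) (priestley_alpha S a)"
    using *[OF bt(2) a]
    by (auto simp: closedin_def points_priestley_space[OF S] eq) (simp add: priestley_alpha_def)
qed

lemma closed_downset_compl_open_upset_of_ideal:
  assumes S: "bounded_sublattice S" and I: "lattice_ideal S I"
    and D: "D = points (priestley_space S) - open_upset_of_ideal S I"
  shows "closedin (ord_topology (priestley_space S)) D"
    and "\<lbrakk>y \<in> D; x \<in> points (priestley_space S); ord_le (priestley_space S) x y\<rbrakk> \<Longrightarrow> x \<in> D"
proof -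
  have "openin (ord_topology (priestley_space S)) (open_upset_of_ideal S I)"
    unfolding open_upset_of_ideal_def using I openin_closedin_priestley_alpha(1)[OF S]
    by (intro openin_Union) (auto simp: lattice_ideal_def)
  then show "closedin (ord_topology (priestley_space S)) D"
    unfolding D by blast
  show "x \<in> D" if "y \<in> D" "x \<in> points (priestley_space S)" "ord_le (priestley_space S) x y"
    using that unfolding D points_priestley_space[OF S]
    by (auto simp: open_upset_of_ideal_def priestley_alpha_def priestley_space_def)
qed

lemma closed_upset_of_filter:
  assumes S: "bounded_sublattice S" and F: "lattice_filter S F"
    and U: "U = closed_upset_of_filter S F"
  shows "closedin (ord_topology (priestley_space S)) U"
    and "\<lbrakk>x \<in> U; y \<in> points (priestley_space S); ord_le (priestley_space S) x y\<rbrakk> \<Longrightarrow> y \<in> U"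
proof -
  show "closedin (ord_topology (priestley_space S)) U"
    unfolding U closed_upset_of_filter_def using F openin_closedin_priestley_alpha(2)[OF S]
    by (intro closedin_Inter) (auto simp: lattice_filter_def)
  show "y \<in> U" if "x \<in> U" "y \<in> points (priestley_space S)" "ord_le (priestley_space S) x y"
    using that unfolding U points_priestley_space[OF S]
    by (auto simp: closed_upset_of_filter_def priestley_alpha_def priestley_space_def)
qed


section \<open>Down-up sums\<close>

text \<open>
  Disjoint copies of the two spaces are provided by the sum type. The construction is only meaningful
  for a closed downset \<open>D\<close> of \<open>X\<close> and a closed upset \<open>U\<close> of \<open>Y\<close>.
\<close>

definition disjoint_sum_topology :: "'p topology \<Rightarrow> 'q topology \<Rightarrow> ('p + 'q) topology" where
  "disjoint_sum_topology T T' = topology (\<lambda>W. openin T (Inl -` W) \<and> openin T' (Inr -` W))"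

lemma openin_disjoint_sum_topology:
  "openin (disjoint_sum_topology T T') W \<longleftrightarrow> openin T (Inl -` W) \<and> openin T' (Inr -` W)"
proof -
  have "istopology (\<lambda>W. openin T (Inl -` W) \<and> openin T' (Inr -` W))"
    by (auto simp: istopology_def vimage_Union)
  then show ?thesis
    by (simp add: disjoint_sum_topology_def)
qed

lemma topspace_disjoint_sum_topology:
  "topspace (disjoint_sum_topology T T') = Inl ` topspace T \<union> Inr ` topspace T'"
proof
  have "Inl -` (Inl ` A \<union> Inr ` B) = A" "Inr -` (Inl ` A \<union> Inr ` B) = B" for A :: "'a set" and B :: "'b set"
    by auto
  then have "openin (disjoint_sum_topology T T') (Inl ` topspace T \<union> Inr ` topspace T')"
    by (simp add: openin_disjoint_sum_topology)
  then show "Inl ` topspace T \<union> Inr ` topspace T' \<subseteq> topspace (disjoint_sum_topology T T')"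
    by (rule openin_subset)
  show "topspace (disjoint_sum_topology T T') \<subseteq> Inl ` topspace T \<union> Inr ` topspace T'"
  proof
    fix z
    assume z: "z \<in> topspace (disjoint_sum_topology T T')"
    have "openin T (Inl -` topspace (disjoint_sum_topology T T'))"
      "openin T' (Inr -` topspace (disjoint_sum_topology T T'))"
      using openin_topspace[of "disjoint_sum_topology T T'"]
      unfolding openin_disjoint_sum_topology by auto
    with z show "z \<in> Inl ` topspace T \<union> Inr ` topspace T'"
      by (cases z) (auto dest: openin_subset)
  qed
qed

fun down_up_le ::
  "'p ordered_space \<Rightarrow> 'q ordered_space \<Rightarrow> 'p set \<Rightarrow> 'q set \<Rightarrow> 'p + 'q \<Rightarrow> 'p + 'q \<Rightarrow> bool" where
  "down_up_le X Y D U (Inl x) (Inl x') \<longleftrightarrow> ord_le X x x'"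
| "down_up_le X Y D U (Inr y) (Inr y') \<longleftrightarrow> ord_le Y y y'"
| "down_up_le X Y D U (Inl x) (Inr y) \<longleftrightarrow> x \<in> D \<and> y \<in> U"
| "down_up_le X Y D U (Inr y) (Inl x) \<longleftrightarrow> False"

definition down_up_sum ::
  "'p ordered_space \<Rightarrow> 'q ordered_space \<Rightarrow> 'p set \<Rightarrow> 'q set \<Rightarrow> ('p + 'q) ordered_space" where
  "down_up_sum X Y D U =
     \<lparr>ord_topology = disjoint_sum_topology (ord_topology X) (ord_topology Y),
      ord_le = down_up_le X Y D U\<rparr>"

end

theory Submission
  imports Defs
begin

text \<open>
  Both projections map the product \<open>K\<close> onto \<open>L\<close> and \<open>M\<close>, because \<open>(l, top)\<close> and \<open>(bot, m)\<close> always lie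
  in \<open>K\<close>. Hence prime filters of \<open>L\<close> and of \<open>M\<close> pull back to \<open>K\<close>. The element \<open>(bot, top)\<close> of \<open>K\<close>
  separates the two kinds of pullback, and every prime filter of \<open>K\<close> arises in this way: it comes
  from \<open>M\<close> if it contains \<open>(bot, top)\<close>, and from \<open>L\<close> otherwise.
\<close>

section \<open>Prime filters and open sets of a bounded sublattice\<close>

lemma ord_le_priestley_space: "ord_le (priestley_space S) = (\<subseteq>)"
  by (simp add: priestley_space_def)

lemma prime_filterD:
  assumes "prime_filter S x"
  shows "x \<subseteq> S"
    and "\<lbrakk>a \<in> x; b \<in> S; a \<le> b\<rbrakk> \<Longrightarrow> b \<in> x"
    and "\<lbrakk>a \<in> x; b \<in> x\<rbrakk> \<Longrightarrow> inf a b \<in> x"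
    and "\<lbrakk>sup a b \<in> x; a \<in> S; b \<in> S\<rbrakk> \<Longrightarrow> a \<in> x \<or> b \<in> x"
  using assms unfolding prime_filter_def lattice_filter_def by blast+

lemma prime_filter_top_bot:
  assumes "bounded_sublattice S" "prime_filter S x"
  shows "top \<in> x" "bot \<notin> x"
  using assms by (auto simp: prime_filter_def lattice_filter_def bounded_sublattice_def)

text \<open>\<open>top\<close> makes the filter nonempty; the absence of \<open>bot\<close>, an
  element of \<open>S\<close>, makes it proper.\<close>

lemma prime_filterI:
  assumes "bounded_sublattice S" "x \<subseteq> S" "top \<in> x" "bot \<notin> x"
    and "\<And>a b. \<lbrakk>a \<in> x; b \<in> S; a \<le> b\<rbrakk> \<Longrightarrow> b \<in> x"
    and "\<And>a b. \<lbrakk>a \<in> x; b \<in> x\<rbrakk> \<Longrightarrow> inf a b \<in> x"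
    and "\<And>a b. \<lbrakk>sup a b \<in> x; a \<in> S; b \<in> S\<rbrakk> \<Longrightarrow> a \<in> x \<or> b \<in> x"
  shows "prime_filter S x"
  using assms unfolding prime_filter_def lattice_filter_def bounded_sublattice_def by blast

text \<open>Inverse image along a bounded lattice homomorphism, for use with \<open>fst\<close> and
  \<open>snd\<close>. Intersecting with \<open>S\<close> turns a homomorphism of the ambient types
  into one of the sublattices.\<close>

lemma prime_filter_vimage:
  fixes h :: "'a::bounded_lattice \<Rightarrow> 'b::bounded_lattice"
  assumes S: "bounded_sublattice S" and T: "bounded_sublattice T" and h: "h ` S \<subseteq> T"
    and inf: "\<And>a b. h (inf a b) = inf (h a) (h b)" and sup: "\<And>a b. h (sup a b) = sup (h a) (h b)"
    and bt: "h bot = bot" "h top = top"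
    and x: "prime_filter T x"
  shows "prime_filter S (h -` x \<inter> S)"
proof (rule prime_filterI[OF S])
  show "b \<in> h -` x \<inter> S" if "a \<in> h -` x \<inter> S" "b \<in> S" "a \<le> b" for a b
  proof -
    \<comment> \<open>Monotonicity comes from preservation of \<open>inf\<close>, as
      \<open>a \<le> b\<close> means \<open>inf a b = a\<close>.\<close>
    have "h a \<le> h b"
      using inf[of a b] \<open>a \<le> b\<close> by (simp add: inf_absorb1 le_iff_inf)
    then show ?thesis
      using that h prime_filterD(2)[OF x, of "h a" "h b"] by auto
  qed
  show "inf a b \<in> h -` x \<inter> S" if "a \<in> h -` x \<inter> S" "b \<in> h -` x \<inter> S" for a b
    using that S prime_filterD(3)[OF x] by (auto simp: inf bounded_sublattice_def)
  show "a \<in> h -` x \<inter> S \<or> b \<in> h -` x \<inter> S" if "sup a b \<in> h -` x \<inter> S" "a \<in> S" "b \<in> S" for a b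
    using that h prime_filterD(4)[OF x, of "h a" "h b"] by (auto simp: sup)
  show "top \<in> h -` x \<inter> S" "bot \<notin> h -` x \<inter> S"
    using S prime_filter_top_bot[OF T x] by (auto simp: bt bounded_sublattice_def)
qed simp

text \<open>Images commute with unions, and every open set is a union of basic sets, so checking the
  basis suffices.\<close>

lemma openin_image_priestley_space:
  assumes S: "bounded_sublattice S"
    and g: "\<And>a b. \<lbrakk>a \<in> S; b \<in> S\<rbrakk> \<Longrightarrow> openin T (g ` (priestley_alpha S a - priestley_alpha S b))"
    and W: "openin (ord_topology (priestley_space S)) W"
  shows "openin T (g ` W)"
proof -
  obtain \<U> where "\<And>B. B \<in> \<U> \<Longrightarrow> \<exists>a\<in>S. \<exists>b\<in>S. B = priestley_alpha S a - priestley_alpha S b"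
    and "W = \<Union>\<U>"
    using W unfolding openin_priestley_space[OF S] by (auto simp: union_of_def arbitrary_def)
  then show ?thesis
    using g by (auto simp: image_Union intro!: openin_Union)
qed

lemma continuous_map_into_priestley_space:
  assumes S: "bounded_sublattice S" and g: "g ` topspace T \<subseteq> {x. prime_filter S x}"
    and op: "\<And>a b. \<lbrakk>a \<in> S; b \<in> S\<rbrakk> \<Longrightarrow>
      openin T (g -` (priestley_alpha S a - priestley_alpha S b) \<inter> topspace T)"
  shows "continuous_map T (ord_topology (priestley_space S)) g"
proof -
  \<comment> \<open>Continuity into a generated topology also requires the image to be covered by
    the generators; their union is the set of all prime filters.\<close>
  have "g ` topspace T \<subseteq> \<Union>{priestley_alpha S a - priestley_alpha S b |a b. a \<in> S \<and> b \<in> S}"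
    using g points_priestley_space[OF S] by (simp add: priestley_space_def)
  then show ?thesis
    unfolding priestley_space_def using op
    by (auto intro!: continuous_on_generated_topo)
qed

lemma bounded_sublattice_UNIV: "bounded_sublattice UNIV"
  by (simp add: bounded_sublattice_def)

lemma openin_priestley_diff:
  assumes "a \<in> S" "b \<in> S"
  shows "openin (ord_topology (priestley_space S)) (priestley_alpha S a - priestley_alpha S b)"
  using assms by (auto simp: priestley_space_def intro!: topology_generated_by_Basis)

section \<open>The pullback map and its values\<close>

text \<open>The candidate homeomorphism, dual to the two projections. The intersection removes pairs
  of the full product that lie outside the ideal-filter product.\<close>

definition prime_filter_pullback ::
  "'a set \<Rightarrow> 'b set \<Rightarrow> 'a set + 'b set \<Rightarrow> ('a \<times> 'b) set" where
  "prime_filter_pullback I F =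
     case_sum (\<lambda>x. fst -` x \<inter> ideal_filter_product I F) (\<lambda>y. snd -` y \<inter> ideal_filter_product I F)"

lemma mem_prime_filter_pullback [simp]:
  "(l, m) \<in> prime_filter_pullback I F (Inl x) \<longleftrightarrow> l \<in> x \<and> (l \<in> I \<or> m \<in> F)"
  "(l, m) \<in> prime_filter_pullback I F (Inr y) \<longleftrightarrow> m \<in> y \<and> (l \<in> I \<or> m \<in> F)"
  by (auto simp: prime_filter_pullback_def ideal_filter_product_def)

context
  fixes I :: "'a::{distrib_lattice, bounded_lattice} set"
    and F :: "'b::{distrib_lattice, bounded_lattice} set"
  assumes I: "lattice_ideal UNIV I" and F: "lattice_filter UNIV F"
begin

private abbreviation "K \<equiv> ideal_filter_product I F"
private abbreviation "f \<equiv> prime_filter_pullback I F"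

lemma bot_mem_ideal: "bot \<in> I" and top_mem_filter: "top \<in> F"
  using I F by (auto simp: lattice_ideal_def lattice_filter_def)

lemma bounded_sublattice_product: "bounded_sublattice K"
  by (rule bounded_sublattice_ideal_filter_product[OF I F])

lemma prime_filter_pullback_Inl: "prime_filter UNIV x \<Longrightarrow> prime_filter K (f (Inl x))"
  unfolding prime_filter_pullback_def sum.case
  by (rule prime_filter_vimage[OF bounded_sublattice_product bounded_sublattice_UNIV]) auto

lemma prime_filter_pullback_Inr: "prime_filter UNIV y \<Longrightarrow> prime_filter K (f (Inr y))"
  unfolding prime_filter_pullback_def sum.case
  by (rule prime_filter_vimage[OF bounded_sublattice_product bounded_sublattice_UNIV]) auto

section \<open>Classification of the prime filters of the product\<close>

text \<open>The trace of \<open>z\<close> on the pairs \<open>(bot, m)\<close> determines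
  \<open>z\<close>: meeting \<open>(l, m)\<close> with \<open>(bot, top)\<close> gives
  \<open>(bot, m)\<close>, which in turn lies below \<open>(l, m)\<close>.\<close>

lemma prime_filter_product_with_bot_top:
  assumes z: "prime_filter K z" and bt: "(bot, top) \<in> z"
  obtains y where "prime_filter UNIV y" "z = f (Inr y)"
proof
  note zD = prime_filterD[OF z]
  have K: "(bot, m) \<in> K" for m
    using bot_mem_ideal by (simp add: ideal_filter_product_def)
  \<comment> \<open>The embedding of \<open>m\<close> as \<open>(bot, m)\<close> preserves
    \<open>inf\<close>, \<open>sup\<close> and \<open>bot\<close> but sends \<open>top\<close> to
    \<open>(bot, top)\<close>, so \<open>bt\<close> is what puts \<open>top\<close> into
    \<open>?y\<close>.\<close>
  let ?y = "{m. (bot, m) \<in> z}"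
  show "prime_filter UNIV ?y"
  proof (rule prime_filterI[OF bounded_sublattice_UNIV])
    show "b \<in> ?y" if "a \<in> ?y" "a \<le> b" for a b
      using zD(2)[of "(bot, a)" "(bot, b)"] that K by simp
    show "inf a b \<in> ?y" if "a \<in> ?y" "b \<in> ?y" for a b
      using zD(3)[of "(bot, a)" "(bot, b)"] that by simp
    show "a \<in> ?y \<or> b \<in> ?y" if "sup a b \<in> ?y" for a b
      using zD(4)[of "(bot, a)" "(bot, b)"] that K by simp
    show "bot \<notin> ?y"
      using prime_filter_top_bot(2)[OF bounded_sublattice_product z] by (simp add: bot_prod_def)
  qed (use bt in auto)
  have eq: "(l, m) \<in> z \<longleftrightarrow> (bot, m) \<in> z" if "(l, m) \<in> K" for l m
    using zD(2)[of "(bot, m)" "(l, m)"] zD(3)[of "(l, m)" "(bot, top)"] bt that by auto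
  show "z = f (Inr ?y)"
  proof (rule set_eqI)
    \<comment> \<open>\<open>eq\<close> covers the pairs in \<open>K\<close>; all other pairs lie in
      neither set.\<close>
    show "p \<in> z \<longleftrightarrow> p \<in> f (Inr ?y)" for p
      using eq[of "fst p" "snd p"] zD(1) by (cases p) (auto simp: ideal_filter_product_def)
  qed
qed

text \<open>Dual argument with joins: \<open>(l, top)\<close> is the join of \<open>(l, m)\<close>
  and \<open>(bot, top)\<close>, so by primeness it lies in \<open>z\<close> only if
  \<open>(l, m)\<close> does. Here \<open>bt\<close> keeps \<open>bot\<close> out of
  \<open>?x\<close>.\<close>

lemma prime_filter_product_without_bot_top:
  assumes z: "prime_filter K z" and bt: "(bot, top) \<notin> z"
  obtains x where "prime_filter UNIV x" "z = f (Inl x)"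
proof
  note zD = prime_filterD[OF z]
  have K: "(l, top) \<in> K" for l
    using top_mem_filter by (simp add: ideal_filter_product_def)
  let ?x = "{l. (l, top) \<in> z}"
  show "prime_filter UNIV ?x"
  proof (rule prime_filterI[OF bounded_sublattice_UNIV])
    show "b \<in> ?x" if "a \<in> ?x" "a \<le> b" for a b
      using zD(2)[of "(a, top)" "(b, top)"] that K by simp
    show "inf a b \<in> ?x" if "a \<in> ?x" "b \<in> ?x" for a b
      using zD(3)[of "(a, top)" "(b, top)"] that by simp
    show "a \<in> ?x \<or> b \<in> ?x" if "sup a b \<in> ?x" for a b
      using zD(4)[of "(a, top)" "(b, top)"] that K by simp
    show "top \<in> ?x"
      using prime_filter_top_bot(1)[OF bounded_sublattice_product z] by (simp add: top_prod_def)
  qed (use bt in auto)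
  have eq: "(l, m) \<in> z \<longleftrightarrow> (l, top) \<in> z" if "(l, m) \<in> K" for l m
    using zD(2)[of "(l, m)" "(l, top)"] zD(4)[of "(l, m)" "(bot, top)"] bt that K by auto
  show "z = f (Inl ?x)"
  proof (rule set_eqI)
    show "p \<in> z \<longleftrightarrow> p \<in> f (Inl ?x)" for p
      using eq[of "fst p" "snd p"] zD(1) by (cases p) (auto simp: ideal_filter_product_def)
  qed
qed

lemma image_prime_filter_pullback:
  "f ` (Inl ` {x. prime_filter UNIV x} \<union> Inr ` {y. prime_filter UNIV y}) = {z. prime_filter K z}"
proof
  show "f ` (Inl ` {x. prime_filter UNIV x} \<union> Inr ` {y. prime_filter UNIV y}) \<subseteq> {z. prime_filter K z}"
    using prime_filter_pullback_Inl prime_filter_pullback_Inr by blast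
  show "{z. prime_filter K z} \<subseteq> f ` (Inl ` {x. prime_filter UNIV x} \<union> Inr ` {y. prime_filter UNIV y})"
  proof
    fix z assume "z \<in> {z. prime_filter K z}"
    then have z: "prime_filter K z" by simp
    show "z \<in> f ` (Inl ` {x. prime_filter UNIV x} \<union> Inr ` {y. prime_filter UNIV y})"
    proof (cases "(bot, top) \<in> z")
      case True
      with z obtain y where "prime_filter UNIV y" "z = f (Inr y)"
        by (rule prime_filter_product_with_bot_top)
      then show ?thesis by blast
    next
      case False
      with z obtain x where "prime_filter UNIV x" "z = f (Inl x)"
        by (rule prime_filter_product_without_bot_top)
      then show ?thesis by blast
    qed
  qed
qed

section \<open>Inclusion of pullbacks and the order of the sum\<close>

text \<open>Within a summand, the pairs \<open>(l, top)\<close> or \<open>(bot, m)\<close>, all in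
  \<open>K\<close>, recover the original filter. Across the summands, the defining condition of
  \<open>K\<close> produces \<open>D\<close> and \<open>U\<close>.\<close>

lemma prime_filter_pullback_subset_iff:
  assumes "p \<in> Inl ` {x. prime_filter UNIV x} \<union> Inr ` {y. prime_filter UNIV y}"
    and "q \<in> Inl ` {x. prime_filter UNIV x} \<union> Inr ` {y. prime_filter UNIV y}"
  shows "f p \<subseteq> f q \<longleftrightarrow>
    down_up_le (priestley_space UNIV) (priestley_space UNIV)
      (points (priestley_space UNIV) - open_upset_of_ideal UNIV I) (closed_upset_of_filter UNIV F) p q"
proof -
  note bt = prime_filter_top_bot[OF bounded_sublattice_UNIV]
  have LL: "f (Inl x) \<subseteq> f (Inl x') \<longleftrightarrow> x \<subseteq> x'" for x x'
    using top_mem_filter by (auto simp: subset_iff)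
  have RR: "f (Inr y) \<subseteq> f (Inr y') \<longleftrightarrow> y \<subseteq> y'" for y y'
    using bot_mem_ideal by (auto simp: subset_iff)
  \<comment> \<open>The right-hand side says that \<open>x\<close> lies in the complement of the
    open upset of \<open>I\<close> and \<open>y\<close> in the closed upset of \<open>F\<close>. It
    suffices for inclusion: if \<open>l \<in> x\<close> then \<open>l \<notin> I\<close>, so a pair
    \<open>(l, m)\<close> in \<open>K\<close> has \<open>m \<in> F\<close>, hence
    \<open>m \<in> y\<close>.\<close>
  have LR: "f (Inl x) \<subseteq> f (Inr y) \<longleftrightarrow> x \<inter> I = {} \<and> F \<subseteq> y"
    if "prime_filter UNIV x" "prime_filter UNIV y" for x y
  proof
    assume sub: "f (Inl x) \<subseteq> f (Inr y)"
    \<comment> \<open>If \<open>l\<close> were in \<open>I\<close>, then \<open>(l, bot)\<close>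
      would be in \<open>K\<close> and inclusion would force \<open>bot \<in> y\<close>.\<close>
    have "l \<notin> I" if "l \<in> x" for l
      using subsetD[OF sub, of "(l, bot)"] that bt(2)[OF \<open>prime_filter UNIV y\<close>] by auto
    moreover have "m \<in> y" if "m \<in> F" for m
      using subsetD[OF sub, of "(top, m)"] that bt(1)[OF \<open>prime_filter UNIV x\<close>] by auto
    ultimately show "x \<inter> I = {} \<and> F \<subseteq> y"
      by blast
  qed auto
  have RL: "\<not> f (Inr y) \<subseteq> f (Inl x)" if "prime_filter UNIV x" "prime_filter UNIV y" for x y
  proof
    assume "f (Inr y) \<subseteq> f (Inl x)"
    from subsetD[OF this, of "(bot, top)"] show False
      using that bt top_mem_filter by auto
  qed
  show ?thesis
    using assms
    by (auto simp: LL RR LR RL points_priestley_space[OF bounded_sublattice_UNIV]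
        open_upset_of_ideal_def closed_upset_of_filter_def priestley_alpha_def)
      (auto simp: ord_le_priestley_space)
qed

text \<open>An order embedding is injective because the order of its domain is antisymmetric; points
  of different summands are never below each other in both directions.\<close>

lemma inj_on_prime_filter_pullback:
  "inj_on f (Inl ` {x. prime_filter UNIV x} \<union> Inr ` {y. prime_filter UNIV y})"
proof (rule inj_onI)
  let ?P = "Inl ` {x::'a set. prime_filter UNIV x} \<union> Inr ` {y::'b set. prime_filter UNIV y}"
  fix p q
  assume pq: "p \<in> ?P" "q \<in> ?P" and "f p = f q"
  then have "f p \<subseteq> f q" "f q \<subseteq> f p"
    by auto
  then show "p = q"
    unfolding prime_filter_pullback_subset_iff[OF pq] prime_filter_pullback_subset_iff[OF pq(2,1)]
    by (cases p; cases q) (auto simp: ord_le_priestley_space)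
qed

section \<open>Continuity and openness of the pullback map\<close>

lemma continuous_map_prime_filter_pullback:
  "continuous_map
     (disjoint_sum_topology (ord_topology (priestley_space UNIV)) (ord_topology (priestley_space UNIV)))
     (ord_topology (priestley_space K)) f"
  (is "continuous_map ?T _ _")
proof (rule continuous_map_into_priestley_space[OF bounded_sublattice_product])
  have T: "topspace ?T = Inl ` {x. prime_filter UNIV x} \<union> Inr ` {y. prime_filter UNIV y}"
    by (simp add: topspace_disjoint_sum_topology points_priestley_space[OF bounded_sublattice_UNIV])
  show "f ` topspace ?T \<subseteq> {x. prime_filter K x}"
    unfolding T image_prime_filter_pullback by simp
  fix a b
  assume ab: "a \<in> K" "b \<in> K"
  let ?W = "f -` (priestley_alpha K a - priestley_alpha K b) \<inter> topspace ?T"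
  \<comment> \<open>On pairs in \<open>K\<close>, membership in a pullback depends on one coordinate
    only, so each half of the preimage is again basic.\<close>
  have "Inl -` ?W = priestley_alpha UNIV (fst a) - priestley_alpha UNIV (fst b)"
    using ab prime_filter_pullback_Inl unfolding T
    by (cases a; cases b) (auto simp: priestley_alpha_def ideal_filter_product_def)
  moreover have "Inr -` ?W = priestley_alpha UNIV (snd a) - priestley_alpha UNIV (snd b)"
    using ab prime_filter_pullback_Inr unfolding T
    by (cases a; cases b) (auto simp: priestley_alpha_def ideal_filter_product_def)
  ultimately show "openin ?T ?W"
    by (simp add: openin_disjoint_sum_topology openin_priestley_diff)
qed

text \<open>Since \<open>(bot, top) \<le> (b, top)\<close>, a prime filter that omits
  \<open>(b, top)\<close> omits \<open>(bot, top)\<close> and so comes from the first lattice. Basic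
  sets therefore have basic images.\<close>

lemma prime_filter_pullback_Inl_image:
  "(\<lambda>x. f (Inl x)) ` (priestley_alpha UNIV a - priestley_alpha UNIV b) =
    priestley_alpha K (a, top) - priestley_alpha K (b, top)" (is "?A = ?B")
proof
  show "?A \<subseteq> ?B"
    using prime_filter_pullback_Inl top_mem_filter by (auto simp: priestley_alpha_def)
  show "?B \<subseteq> ?A"
  proof
    fix z assume "z \<in> ?B"
    then have z: "prime_filter K z" "(a, top) \<in> z" "(b, top) \<notin> z"
      by (auto simp: priestley_alpha_def)
    have "(bot, top) \<notin> z"
      using prime_filterD(2)[OF z(1), of "(bot, top)" "(b, top)"] z(3) top_mem_filter
      by (auto simp: ideal_filter_product_def)
    then obtain x where "prime_filter UNIV x" "z = f (Inl x)"
      using prime_filter_product_without_bot_top z(1) by blast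
    then show "z \<in> ?A"
      using z top_mem_filter by (auto simp: priestley_alpha_def)
  qed
qed

text \<open>Here the positive part selects the summand: \<open>(bot, a) \<le> (bot, top)\<close>, so
  any prime filter containing \<open>(bot, a)\<close> comes from the second lattice.\<close>

lemma prime_filter_pullback_Inr_image:
  "(\<lambda>y. f (Inr y)) ` (priestley_alpha UNIV a - priestley_alpha UNIV b) =
    priestley_alpha K (bot, a) - priestley_alpha K (bot, b)" (is "?A = ?B")
proof
  show "?A \<subseteq> ?B"
    using prime_filter_pullback_Inr bot_mem_ideal by (auto simp: priestley_alpha_def)
  show "?B \<subseteq> ?A"
  proof
    fix z assume "z \<in> ?B"
    then have z: "prime_filter K z" "(bot, a) \<in> z" "(bot, b) \<notin> z"
      by (auto simp: priestley_alpha_def)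
    have "(bot, top) \<in> z"
      using prime_filterD(2)[OF z(1), of "(bot, a)" "(bot, top)"] z(2) top_mem_filter
      by (auto simp: ideal_filter_product_def)
    then obtain y where "prime_filter UNIV y" "z = f (Inr y)"
      using prime_filter_product_with_bot_top z(1) by blast
    then show "z \<in> ?A"
      using z bot_mem_ideal by (auto simp: priestley_alpha_def)
  qed
qed

lemma open_map_prime_filter_pullback:
  "open_map
     (disjoint_sum_topology (ord_topology (priestley_space UNIV)) (ord_topology (priestley_space UNIV)))
     (ord_topology (priestley_space K)) f"
  unfolding open_map_def
proof (intro allI impI)
  fix W :: "('a set + 'b set) set"
  assume "openin (disjoint_sum_topology (ord_topology (priestley_space UNIV))
    (ord_topology (priestley_space UNIV))) W"
  then have W: "openin (ord_topology (priestley_space UNIV)) (Inl -` W)"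
      "openin (ord_topology (priestley_space UNIV)) (Inr -` W)"
    by (simp_all add: openin_disjoint_sum_topology)
  have "openin (ord_topology (priestley_space K)) ((\<lambda>x. f (Inl x)) ` (Inl -` W))"
    by (rule openin_image_priestley_space[OF bounded_sublattice_UNIV _ W(1)])
      (simp add: prime_filter_pullback_Inl_image openin_priestley_diff ideal_filter_product_def top_mem_filter)
  moreover have "openin (ord_topology (priestley_space K)) ((\<lambda>y. f (Inr y)) ` (Inr -` W))"
    by (rule openin_image_priestley_space[OF bounded_sublattice_UNIV _ W(2)])
      (simp add: prime_filter_pullback_Inr_image openin_priestley_diff ideal_filter_product_def bot_mem_ideal)
  \<comment> \<open>An open set of the sum splits into its two halves, and the image of each half is
    already known to be open.\<close>
  moreover have "f ` W = (\<lambda>x. f (Inl x)) ` (Inl -` W) \<union> (\<lambda>y. f (Inr y)) ` (Inr -` W)"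
  proof -
    have "W = Inl ` (Inl -` W) \<union> Inr ` (Inr -` W)"
    proof (rule set_eqI)
      show "w \<in> W \<longleftrightarrow> w \<in> Inl ` (Inl -` W) \<union> Inr ` (Inr -` W)" for w
        by (cases w) auto
    qed
    then show ?thesis
      by (metis image_Un image_image)
  qed
  ultimately show "openin (ord_topology (priestley_space K)) (f ` W)"
    by auto
qed

end

theorem theorem4p5:
  fixes I :: "'a::{distrib_lattice, bounded_lattice} set"
    and F :: "'b::{distrib_lattice, bounded_lattice} set"
    and X :: "'a set ordered_space" and Y :: "'b set ordered_space"
    and V D :: "'a set set" and U :: "'b set set"
  assumes "lattice_ideal UNIV I"
    and "lattice_filter UNIV F"
    and "X = priestley_space UNIV"
    and "Y = priestley_space UNIV"
    and "V = open_upset_of_ideal UNIV I"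
    and "D = points X - V"
    and "U = closed_upset_of_filter UNIV F"
  shows "homeo_order_isomorphic (down_up_sum X Y D U) (priestley_space (ideal_filter_product I F))"
proof -
  note IF = assms(1,2)
  let ?f = "prime_filter_pullback I F"
  have pts: "topspace (disjoint_sum_topology (ord_topology X) (ord_topology Y)) =
      Inl ` {x. prime_filter UNIV x} \<union> Inr ` {y. prime_filter UNIV y}"
    by (simp add: topspace_disjoint_sum_topology assms(3,4)
        points_priestley_space[OF bounded_sublattice_UNIV])
  have "homeomorphic_map (disjoint_sum_topology (ord_topology X) (ord_topology Y))
      (ord_topology (priestley_space (ideal_filter_product I F))) ?f"
  \<comment> \<open>The inverse is continuous because the bijection is open.\<close>
  proof (rule bijective_open_imp_homeomorphic_map)
    show "?f ` topspace (disjoint_sum_topology (ord_topology X) (ord_topology Y)) =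
        points (priestley_space (ideal_filter_product I F))"
      unfolding pts image_prime_filter_pullback[OF IF]
        points_priestley_space[OF bounded_sublattice_product[OF IF]] ..
    show "inj_on ?f (topspace (disjoint_sum_topology (ord_topology X) (ord_topology Y)))"
      unfolding pts by (rule inj_on_prime_filter_pullback[OF IF])
  qed (simp_all add: assms(3,4) continuous_map_prime_filter_pullback[OF IF]
      open_map_prime_filter_pullback[OF IF])
  moreover have "down_up_le X Y D U p q \<longleftrightarrow> ?f p \<subseteq> ?f q"
    if "p \<in> Inl ` {x. prime_filter UNIV x} \<union> Inr ` {y. prime_filter UNIV y}"
      "q \<in> Inl ` {x. prime_filter UNIV x} \<union> Inr ` {y. prime_filter UNIV y}" for p q
    using prime_filter_pullback_subset_iff[OF IF that] assms(3-7) by simp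
  ultimately show ?thesis
    unfolding homeo_order_isomorphic_def ord_le_priestley_space
    by (intro exI[of _ ?f]) (simp add: down_up_sum_def pts)
qed

end
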